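(* Let $\epsilon>0$. For any $m=o(\sqrt{n/\log n})$, no algorithm that makes only polynomially many (in $n$) value-oracle queries can approximate submodular load balancing (SLB) to within a factor of $(1-\epsilon)m$, even in the homogeneous setting where $f_1=\dots=f_m$.
   Context: Given a ground set $V$ with $|V|=n$, an integer $m$, and normalized ($f_i(\emptyset)=0$), monotone non-decreasing, submodular functions $f_1,\dots,f_m:2^V\to\mathbb{R}$ accessible through a value oracle, submodular load balancing (SLB) is the problem $\min_{\pi\in\Pi}\max_{i} f_i(A_i^\pi)$, where $\Pi$ is the set of ordered partitions $\pi=(A_1^\pi,\dots,A_m^\pi)$ of $V$ into $m$ pairwise disjoint (possibly empty) blocks covering $V$. An algorithm approximates SLB within factor $\rho\ge1$ if it always outputs $\hat\pi\in\Pi$ with $\max_i f_i(A_i^{\hat\pi})\le\rho\min_{\pi\in\Pi}\max_i f_i(A_i^\pi)$. *)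

theory Defs
  imports Complex_Main "HOL-Library.Landau_Symbols" "HOL-Library.Disjoint_Sets"
    "HOL-Computational_Algebra.Polynomial"
begin

definition normalized :: "('v set \<Rightarrow> real) \<Rightarrow> bool" where
  "normalized g \<longleftrightarrow> g {} = 0"

definition submodular_on :: "'v set \<Rightarrow> ('v set \<Rightarrow> real) \<Rightarrow> bool" where
  "submodular_on V g \<longleftrightarrow>
     (\<forall>S T. S \<subseteq> V \<longrightarrow> T \<subseteq> V \<longrightarrow> g (S \<union> T) + g (S \<inter> T) \<le> g S + g T)"

text \<open>The functions \<open>f\<^sub>1, \<dots>, f\<^sub>m\<close> are indexed by \<open>0, \<dots>, m - 1\<close>; only their values on subsets
  of \<open>V\<close> matter.\<close>

definition slb_instances :: "'v set \<Rightarrow> nat \<Rightarrow> (nat \<Rightarrow> 'v set \<Rightarrow> real) set" where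
  "slb_instances V m =
     {f. \<forall>i<m. normalized (f i) \<and> mono_on (Pow V) (f i) \<and> submodular_on V (f i)}"

definition homogeneous_slb_instances :: "'v set \<Rightarrow> nat \<Rightarrow> (nat \<Rightarrow> 'v set \<Rightarrow> real) set" where
  "homogeneous_slb_instances V m =
     {f \<in> slb_instances V m. \<forall>i<m. \<forall>j<m. \<forall>S\<subseteq>V. f i S = f j S}"

definition ordered_partitions :: "'v set \<Rightarrow> nat \<Rightarrow> 'v set list set" where
  "ordered_partitions V m =
     {A. length A = m \<and> disjoint_family_on (\<lambda>i. A ! i) {..<m} \<and> (\<Union>i<m. A ! i) = V}"

definition max_load :: "nat \<Rightarrow> (nat \<Rightarrow> 'v set \<Rightarrow> real) \<Rightarrow> 'v set list \<Rightarrow> real" where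
  "max_load m f A = Max ((\<lambda>i. f i (A ! i)) ` {..<m})"

definition slb_opt :: "'v set \<Rightarrow> nat \<Rightarrow> (nat \<Rightarrow> 'v set \<Rightarrow> real) \<Rightarrow> real" where
  "slb_opt V m f = Min (max_load m f ` ordered_partitions V m)"

lemma finite_ordered_partitions:
  assumes "finite V"
  shows "finite (ordered_partitions V m)"
proof (rule finite_subset)
  show "ordered_partitions V m \<subseteq> {A. set A \<subseteq> Pow V \<and> length A = m}"
    by (force simp: ordered_partitions_def in_set_conv_nth)
  show "finite {A. set A \<subseteq> Pow V \<and> length A = m}"
    using assms by (intro finite_lists_length_eq) simp
qed

lemma ordered_partitions_nonempty:
  assumes "1 \<le> m"
  shows "ordered_partitions V m \<noteq> {}"
proof -
  have "map (\<lambda>i. if i = 0 then V else {}) [0..<m] \<in> ordered_partitions V m"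
    using assms
    by (auto simp: ordered_partitions_def disjoint_family_on_def split: if_splits intro!: bexI[of _ 0])
  then show ?thesis by blast
qed

text \<open>A query algorithm on a fixed ground set and a fixed number of blocks is an adaptive decision
  tree: \<open>Query i S k\<close> asks for \<open>f\<^sub>i(S)\<close> and continues with \<open>k\<close> applied to the answer, and
  \<open>Flip k\<close> tosses an internal coin. Computation between queries is unrestricted, and only
  queries are counted.\<close>

datatype 'v query_alg =
    Output "'v set list"
  | Query nat "'v set" "real \<Rightarrow> 'v query_alg"
  | Flip "bool \<Rightarrow> 'v query_alg"

text \<open>\<open>run_result orc a q A\<close>: some run of \<open>a\<close> with oracle \<open>orc\<close> outputs \<open>A\<close> after exactly \<open>q\<close>
  queries. The runs differ only in their coin tosses.\<close>

inductive run_result ::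
  "(nat \<Rightarrow> 'v set \<Rightarrow> real) \<Rightarrow> 'v query_alg \<Rightarrow> nat \<Rightarrow> 'v set list \<Rightarrow> bool"
  for orc where
  "run_result orc (Output A) 0 A"
| "run_result orc (k (orc i S)) q A \<Longrightarrow> run_result orc (Query i S k) (Suc q) A"
| "run_result orc (k b) q A \<Longrightarrow> run_result orc (Flip k) q A"

lemma run_result_exists: "\<exists>q A. run_result orc a q A"
  by (induction a) (blast intro: run_result.intros)+

text \<open>Ill-formed queries get the uninformative answer 0.\<close>

definition value_oracle ::
  "'v set \<Rightarrow> nat \<Rightarrow> (nat \<Rightarrow> 'v set \<Rightarrow> real) \<Rightarrow> nat \<Rightarrow> 'v set \<Rightarrow> real" where
  "value_oracle V m f i S = (if i < m \<and> S \<subseteq> V then f i S else 0)"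

definition approximates_slb_on ::
  "(nat \<Rightarrow> 'v set \<Rightarrow> real) set \<Rightarrow> 'v set \<Rightarrow> nat \<Rightarrow> real \<Rightarrow> 'v query_alg \<Rightarrow> bool" where
  "approximates_slb_on F V m \<rho> a \<longleftrightarrow>
     (\<forall>f\<in>F. \<forall>q A. run_result (value_oracle V m f) a q A \<longrightarrow>
        A \<in> ordered_partitions V m \<and> max_load m f A \<le> \<rho> * slb_opt V m f)"

text \<open>Below, \<open>n\<close> is the size of the ground set \<open>V n\<close>, and \<open>alg n\<close> is the algorithm's behaviour on
  inputs with that ground set and \<open>m n\<close> blocks.\<close>

definition polynomially_many_queries_on ::
  "(nat \<Rightarrow> (nat \<Rightarrow> 'v set \<Rightarrow> real) set) \<Rightarrow> (nat \<Rightarrow> 'v set) \<Rightarrow> (nat \<Rightarrow> nat) \<Rightarrow>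
   (nat \<Rightarrow> 'v query_alg) \<Rightarrow> bool" where
  "polynomially_many_queries_on F V m alg \<longleftrightarrow>
     (\<exists>p :: real poly. \<forall>n. \<forall>f\<in>F n. \<forall>q A.
        run_result (value_oracle (V n) (m n) f) (alg n) q A \<longrightarrow> real q \<le> poly p (real n))"

end

theory Submission
  imports Defs "HOL-Library.FuncSet"
begin

text \<open>The reference instance \<open>S \<mapsto> min k |S|\<close>, where \<open>k = \<lceil>n/m\<rceil>\<close>, gives no information
  about which sets of size \<open>k\<close> are cheap, and every partition has load \<open>k\<close> under it. Colour the
  ground set uniformly and independently with \<open>m\<close> colours and let each colour class contribute at
  most \<open>\<beta> = (1 + \<epsilon>) k / m\<close> to the value. The colour classes form a partition of load at most
  \<open>\<beta>\<close>, while by a Chernoff bound the value of a fixed set changes with probability at most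
  \<open>m exp (- c n / m\<^sup>2)\<close> for some \<open>c > 0\<close> depending only on \<open>\<epsilon>\<close>. As \<open>m = o(\<surd>(n / ln n))\<close>, this is smaller
  than every inverse polynomial, so a union bound yields one colouring that changes the value
  neither of a set queried in the run on the reference instance nor of a block of its output. The
  run on the coloured instance is then the same, and its output has load
  \<open>k > (1 - \<epsilon>) m \<beta>\<close>.\<close>

section \<open>Submodularity\<close>

text \<open>If \<open>b\<close> is at most \<open>g S\<close> or \<open>g T\<close>, then by
  monotonicity it is at most \<open>g (S \<union> T)\<close>, and it remains to compare
  \<open>g (S \<inter> T)\<close> with the other set. If \<open>b\<close> exceeds both, the cap can
  only lower the left side.\<close>

lemma submodular_on_min:
  assumes "submodular_on V g" "mono_on (Pow V) g"
  shows "submodular_on V (\<lambda>S. min b (g S))"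
  unfolding submodular_on_def
proof (intro allI impI)
  fix S T assume ST: "S \<subseteq> V" "T \<subseteq> V"
  have "g (S \<union> T) + g (S \<inter> T) \<le> g S + g T"
    using assms(1) ST by (simp add: submodular_on_def)
  moreover have "g (S \<inter> T) \<le> g S" "g (S \<inter> T) \<le> g T" "g S \<le> g (S \<union> T)" "g T \<le> g (S \<union> T)"
    using ST by (auto intro!: mono_onD[OF assms(2)])
  ultimately show "min b (g (S \<union> T)) + min b (g (S \<inter> T)) \<le> min b (g S) + min b (g T)"
    by (auto simp: min_def)
qed

lemma mono_on_min_const:
  fixes g :: "'a::order \<Rightarrow> real"
  assumes "mono_on A g"
  shows "mono_on A (\<lambda>S. min b (g S))"
  using assms unfolding mono_on_def by (meson min.mono order_refl)

lemma submodular_on_sum: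
  assumes "\<And>j. j \<in> J \<Longrightarrow> submodular_on V (g j)"
  shows "submodular_on V (\<lambda>S. \<Sum>j\<in>J. g j S)"
  using assms unfolding submodular_on_def
  by (simp add: sum.distrib[symmetric] sum_mono)

lemma mono_on_sum:
  fixes g :: "'j \<Rightarrow> 'a::order \<Rightarrow> real"
  assumes "\<And>j. j \<in> J \<Longrightarrow> mono_on A (g j)"
  shows "mono_on A (\<lambda>S. \<Sum>j\<in>J. g j S)"
  using assms unfolding mono_on_def by (blast intro: sum_mono)

lemma submodular_on_card_filter:
  assumes "finite V"
  shows "submodular_on V (\<lambda>S. real (card {v \<in> S. P v}))"
  unfolding submodular_on_def
proof (intro allI impI)
  fix S T assume "S \<subseteq> V" "T \<subseteq> V"
  then have "finite {v \<in> S. P v}" "finite {v \<in> T. P v}"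
    using assms by (auto intro: finite_subset)
  from card_Un_Int[OF this]
  have "card {v \<in> S. P v} + card {v \<in> T. P v}
      = card ({v \<in> S. P v} \<union> {v \<in> T. P v}) + card ({v \<in> S. P v} \<inter> {v \<in> T. P v})" .
  moreover have "{v \<in> S. P v} \<union> {v \<in> T. P v} = {v \<in> S \<union> T. P v}"
    "{v \<in> S. P v} \<inter> {v \<in> T. P v} = {v \<in> S \<inter> T. P v}"
    by auto
  ultimately have "card {v \<in> S. P v} + card {v \<in> T. P v}
      = card {v \<in> S \<union> T. P v} + card {v \<in> S \<inter> T. P v}"
    by simp
  then show "real (card {v \<in> S \<union> T. P v}) + real (card {v \<in> S \<inter> T. P v})
      \<le> real (card {v \<in> S. P v}) + real (card {v \<in> T. P v})"
    by linarith
qed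

lemma mono_on_card_filter:
  assumes "finite V"
  shows "mono_on (Pow V) (\<lambda>S. real (card {v \<in> S. P v}))"
  using assms by (auto simp: mono_on_def intro!: card_mono intro: finite_subset)

section \<open>The two indistinguishable instances\<close>

text \<open>On finite sets this is the rank function of the uniform matroid of rank
  \<open>k\<close>.\<close>

definition capped_card :: "nat \<Rightarrow> 'v set \<Rightarrow> real" where
  "capped_card k S = min (real k) (real (card S))"

text \<open>For natural \<open>\<beta>\<close> and finite sets, this is the rank function of a
  partition matroid with capacity \<open>\<beta>\<close> per colour, truncated to rank
  \<open>k\<close>. The cap is real because \<open>(1 + \<epsilon>) * k / m\<close> need not be an
  integer.\<close>

definition colour_capped_card :: "nat \<Rightarrow> nat \<Rightarrow> real \<Rightarrow> ('v \<Rightarrow> nat) \<Rightarrow> 'v set \<Rightarrow> real" where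
  "colour_capped_card m k \<beta> c S =
     min (real k) (\<Sum>j<m. min \<beta> (real (card {v \<in> S. c v = j})))"

lemma capped_card_instance:
  assumes "finite V"
  shows "(\<lambda>_. capped_card k) \<in> homogeneous_slb_instances V m"
proof -
  have "normalized (capped_card k)"
    by (simp add: normalized_def capped_card_def)
  moreover have "mono_on (Pow V) (capped_card k)"
    using mono_on_min_const[OF mono_on_card_filter[OF assms, of "\<lambda>_. True"]]
    unfolding capped_card_def by simp
  moreover have "submodular_on V (capped_card k)"
    using submodular_on_min[OF submodular_on_card_filter mono_on_card_filter, OF assms assms,
        of "real k" "\<lambda>_. True"]
    unfolding capped_card_def by simp
  ultimately show ?thesis
    unfolding homogeneous_slb_instances_def slb_instances_def by blast
qed

lemma colour_capped_card_instance:
  assumes "finite V" "\<beta> \<ge> 0"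
  shows "(\<lambda>_. colour_capped_card m k \<beta> c) \<in> homogeneous_slb_instances V m'"
proof -
  let ?g = "\<lambda>S. \<Sum>j<m. min \<beta> (real (card {v \<in> S. c v = j}))"
  have mono: "mono_on (Pow V) ?g"
    by (intro mono_on_sum mono_on_min_const mono_on_card_filter assms)
  have sub: "submodular_on V ?g"
    by (intro submodular_on_sum submodular_on_min mono_on_card_filter submodular_on_card_filter assms)
  \<comment> \<open>At the empty set every summand is \<open>min \<beta> 0\<close>, which vanishes
    since \<open>\<beta> \<ge> 0\<close>.\<close>
  have "normalized (colour_capped_card m k \<beta> c)"
    using assms by (simp add: normalized_def colour_capped_card_def)
  moreover have "mono_on (Pow V) (colour_capped_card m k \<beta> c)"
    using mono_on_min_const[OF mono] unfolding colour_capped_card_def .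
  moreover have "submodular_on V (colour_capped_card m k \<beta> c)"
    using submodular_on_min[OF sub mono] unfolding colour_capped_card_def .
  ultimately show ?thesis
    unfolding homogeneous_slb_instances_def slb_instances_def by blast
qed

lemma sum_card_colour_classes:
  fixes m :: nat
  assumes "finite S" "c ` S \<subseteq> {..<m}"
  shows "(\<Sum>j<m. card {v \<in> S. c v = j}) = card S"
  using sum.group[OF assms(1) finite_lessThan assms(2), of "\<lambda>_. 1::nat"] by simp

text \<open>For \<open>|S| > k\<close> it suffices to control a subset of size \<open>k\<close>, so \<open>S\<close> itself is allowed to
  exceed the cap \<open>\<beta>\<close> in its colour classes.\<close>

lemma colour_capped_card_eq_capped_card:
  assumes S: "finite S" "c ` S \<subseteq> {..<m}"
    and S': "S' \<subseteq> S" "card S' = min k (card S)"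
    and cap: "\<And>j. j < m \<Longrightarrow> real (card {v \<in> S'. c v = j}) \<le> \<beta>"
  shows "colour_capped_card m k \<beta> c S = capped_card k S"
proof -
  let ?g = "\<lambda>S. \<Sum>j<m. min \<beta> (real (card {v \<in> S. c v = j}))"
  have fin': "finite S'" "c ` S' \<subseteq> {..<m}"
    using S S' finite_subset by auto
  have "?g S' = (\<Sum>j<m. real (card {v \<in> S'. c v = j}))"
    using cap by (intro sum.cong) (auto simp: min_def intro: antisym)
  also have "\<dots> = real (card S')"
    using sum_card_colour_classes[OF fin'] by (metis of_nat_sum)
  finally have lower: "real (card S') = ?g S'" by simp
  \<comment> \<open>The chain \<open>min k |S| = ?g S' \<le> ?g S \<le> |S|\<close> pins down
    \<open>min k (?g S)\<close>.\<close>
  have "?g S' \<le> ?g S"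
    using S S' by (intro sum_mono min.mono) (auto intro!: card_mono)
  moreover have "?g S \<le> (\<Sum>j<m. real (card {v \<in> S. c v = j}))"
    by (intro sum_mono) simp
  moreover have "\<dots> = real (card S)"
    using sum_card_colour_classes[OF S] by (metis of_nat_sum)
  ultimately show ?thesis
    using lower S'(2) unfolding colour_capped_card_def capped_card_def by linarith
qed

section \<open>Random colourings\<close>

text \<open>Divided by the number \<open>m ^ card V\<close> of colourings, the left side is the
  expectation of \<open>t ^ X\<close> for \<open>X\<close> binomial with parameters
  \<open>card S\<close> and \<open>1 / m\<close>. It equals
  \<open>(1 + (t - 1) / m) ^ card S\<close>, and \<open>1 + x \<le> exp x\<close> finishes.\<close>

lemma colouring_moment:
  fixes t :: real
  assumes "finite V" "S \<subseteq> V" "i < m" "t \<ge> 1"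
  shows "(\<Sum>c \<in> V \<rightarrow>\<^sub>E {..<m}. t ^ card {v \<in> S. c v = i})
      \<le> real m ^ card V * exp ((t - 1) * real (card S) / real m)"
proof -
  have "(\<Sum>c \<in> V \<rightarrow>\<^sub>E {..<m}. t ^ card {v \<in> S. c v = i})
      = (\<Sum>c \<in> V \<rightarrow>\<^sub>E {..<m}. \<Prod>v\<in>V. if v \<in> S \<and> c v = i then t else 1)"
  proof (rule sum.cong[OF refl])
    fix c :: "'a \<Rightarrow> nat"
    have "(\<Prod>v\<in>V. if v \<in> S \<and> c v = i then t else 1) = (\<Prod>v\<in>{v \<in> S. c v = i}. t)"
      using assms(1,2) by (intro prod.mono_neutral_cong_right) auto
    then show "t ^ card {v \<in> S. c v = i} = (\<Prod>v\<in>V. if v \<in> S \<and> c v = i then t else 1)"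
      by simp
  qed
  \<comment> \<open>Independence of the colours of distinct elements.\<close>
  also have "\<dots> = (\<Prod>v\<in>V. \<Sum>j<m. if v \<in> S \<and> j = i then t else 1)"
    using prod_sum_PiE[of V "\<lambda>_. {..<m}" "\<lambda>v j. if v \<in> S \<and> j = i then t else 1"] assms(1)
    by simp
  also have "\<dots> = (\<Prod>v\<in>V. if v \<in> S then real m + (t - 1) else real m)"
  proof (rule prod.cong[OF refl])
    fix v
    have "(\<Sum>j<m. if j = i then t else 1) = (\<Sum>j<m. 1 + (if j = i then t - 1 else 0))"
      by (intro sum.cong) auto
    also have "\<dots> = real m + (t - 1)"
      using assms(3) by (simp add: sum.distrib)
    finally show "(\<Sum>j<m. if v \<in> S \<and> j = i then t else 1)
        = (if v \<in> S then real m + (t - 1) else real m)" by simp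
  qed
  also have "\<dots> = (\<Prod>v\<in>V. real m * (if v \<in> S then 1 + (t - 1) / real m else 1))"
    using assms(3) by (intro prod.cong) (auto simp: field_simps)
  also have "\<dots> = real m ^ card V * (\<Prod>v\<in>V. if v \<in> S then 1 + (t - 1) / real m else 1)"
    by (simp add: prod.distrib)
  also have "(\<Prod>v\<in>V. if v \<in> S then 1 + (t - 1) / real m else 1) = (1 + (t - 1) / real m) ^ card S"
    using assms(1,2) by (simp add: prod.If_cases Int_absorb1)
  also have "\<dots> \<le> exp ((t - 1) / real m) ^ card S"
    using assms(4) by (intro power_mono exp_ge_add_one_self) auto
  also have "\<dots> = exp ((t - 1) * real (card S) / real m)"
    by (simp add: exp_of_nat_mult[symmetric] field_simps)
  finally show ?thesis by (simp add: mult_left_mono)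
qed

section \<open>Tail bound and union bounds\<close>

text \<open>The exponent, per unit of mean, in the multiplicative Chernoff bound for exceeding
  \<open>1 + \<delta>\<close> times the mean.\<close>

definition chernoff_rate :: "real \<Rightarrow> real" where
  "chernoff_rate \<delta> = (1 + \<delta>) * ln (1 + \<delta>) - \<delta>"

lemma chernoff_rate_pos:
  assumes "\<delta> > 0"
  shows "chernoff_rate \<delta> > 0"
proof -
  \<comment> \<open>Strict because \<open>ln y = y - 1\<close> forces \<open>y = 1\<close>.\<close>
  have "ln (1 / (1 + \<delta>)) < 1 / (1 + \<delta>) - 1"
    using assms ln_le_minus_one[of "1 / (1 + \<delta>)"] ln_eq_minus_one[of "1 / (1 + \<delta>)"]
    by (fastforce simp: order_less_le)
  then have "(1 + \<delta>) * (- ln (1 + \<delta>)) < (1 + \<delta>) * (1 / (1 + \<delta>) - 1)"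
    using assms by (intro mult_strict_left_mono) (auto simp: ln_div)
  also have "\<dots> = - \<delta>" using assms by (simp add: field_simps)
  finally show ?thesis by (simp add: chernoff_rate_def)
qed

text \<open>Markov's inequality for \<open>t ^ X\<close>, in counting form. The choice
  \<open>t = 1 + \<delta>\<close> minimises the exponent
  \<open>(t - 1) * k / m - (1 + \<delta>) * k / m * ln t\<close>.\<close>

lemma card_colourings_exceeding_cap:
  assumes "finite V" "S \<subseteq> V" "card S \<le> k" "i < m" "\<delta> > 0"
  shows "real (card {c \<in> V \<rightarrow>\<^sub>E {..<m}.
            real (card {v \<in> S. c v = i}) > (1 + \<delta>) * real k / real m})
      \<le> real m ^ card V * exp (- chernoff_rate \<delta> * real k / real m)"
    (is "real (card ?B) \<le> _")
proof -
  let ?t = "1 + \<delta>" and ?b = "(1 + \<delta>) * real k / real m"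
  have fin: "finite (V \<rightarrow>\<^sub>E {..<m})" using assms(1) by (intro finite_PiE) auto
  have "real (card ?B) * ?t powr ?b = (\<Sum>c\<in>?B. ?t powr ?b)" by simp
  also have "\<dots> \<le> (\<Sum>c\<in>?B. ?t ^ card {v \<in> S. c v = i})"
  proof (rule sum_mono)
    fix c assume "c \<in> ?B"
    then have "?t powr ?b \<le> ?t powr real (card {v \<in> S. c v = i})"
      using assms(5) by (intro powr_mono) auto
    then show "?t powr ?b \<le> ?t ^ card {v \<in> S. c v = i}"
      using assms(5) by (simp add: powr_realpow)
  qed
  also have "\<dots> \<le> (\<Sum>c \<in> V \<rightarrow>\<^sub>E {..<m}. ?t ^ card {v \<in> S. c v = i})"
    using fin assms(5) by (intro sum_mono2) auto
  also have "\<dots> \<le> real m ^ card V * exp ((?t - 1) * real (card S) / real m)"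
    using assms by (intro colouring_moment) auto
  also have "\<dots> \<le> real m ^ card V * exp (\<delta> * real k / real m)"
    using assms by (intro mult_left_mono) (auto intro!: divide_right_mono mult_left_mono)
  finally have "real (card ?B) * ?t powr ?b \<le> real m ^ card V * exp (\<delta> * real k / real m)" .
  then have "real (card ?B) \<le> real m ^ card V * exp (\<delta> * real k / real m) / ?t powr ?b"
    using assms(5) by (simp add: field_simps)
  also have "\<dots> = real m ^ card V * exp (\<delta> * real k / real m - ?b * ln ?t)"
    using assms(5) by (simp add: powr_def exp_diff)
  also have "\<delta> * real k / real m - ?b * ln ?t = - chernoff_rate \<delta> * real k / real m"
    using assms(4) by (simp add: chernoff_rate_def field_simps)
  finally show ?thesis .
qed

lemma card_distinguishing_colourings:
  assumes "finite V" "S \<subseteq> V" "\<delta> > 0"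
  shows "real (card {c \<in> V \<rightarrow>\<^sub>E {..<m}.
            colour_capped_card m k ((1 + \<delta>) * real k / real m) c S \<noteq> capped_card k S})
      \<le> real m * (real m ^ card V * exp (- chernoff_rate \<delta> * real k / real m))"
    (is "real (card ?D) \<le> _")
proof -
  let ?C = "V \<rightarrow>\<^sub>E {..<m}" and ?b = "(1 + \<delta>) * real k / real m"
  have finC: "finite ?C" using assms(1) by (intro finite_PiE) auto
  have finS: "finite S" using assms finite_subset by blast
  \<comment> \<open>\<open>S'\<close> is fixed before the colouring, so the tail bound applies to
    it. A colouring that changes the value of \<open>S\<close> must overload some colour in
    \<open>S'\<close>, and the \<open>m\<close> colours give the factor \<open>m\<close>.\<close>
  obtain S' where S': "S' \<subseteq> S" "card S' = min k (card S)"
    using obtain_subset_with_card_n[of "min k (card S)" S] by auto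
  let ?B = "\<lambda>i. {c \<in> ?C. real (card {v \<in> S'. c v = i}) > ?b}"
  have "?D \<subseteq> (\<Union>i<m. ?B i)"
  proof
    fix c assume c: "c \<in> ?D"
    then have "c ` S \<subseteq> {..<m}" using assms(2) by (auto dest: PiE_mem)
    then have "\<exists>j<m. \<not> real (card {v \<in> S'. c v = j}) \<le> ?b"
      using colour_capped_card_eq_capped_card[OF finS _ S'] c by blast
    then show "c \<in> (\<Union>i<m. ?B i)" using c by (auto simp: not_le)
  qed
  then have "card ?D \<le> card (\<Union>i<m. ?B i)"
    using finC by (intro card_mono) auto
  also have "\<dots> \<le> (\<Sum>i<m. card (?B i))" by (intro card_UN_le) simp
  finally have "real (card ?D) \<le> (\<Sum>i<m. real (card (?B i)))"
    by (simp only: of_nat_sum[symmetric] of_nat_le_iff)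
  also have "\<dots> \<le> (\<Sum>i<m. real m ^ card V * exp (- chernoff_rate \<delta> * real k / real m))"
    using assms S' by (intro sum_mono card_colourings_exceeding_cap) auto
  finally show ?thesis by simp
qed

text \<open>The probabilistic method as a count: otherwise the colourings that betray some member of
  \<open>Q\<close> would exhaust all \<open>m ^ card V\<close> of them, but the union bound leaves
  some over.\<close>

lemma exists_indistinguishable_colouring:
  assumes "finite V" "\<delta> > 0" "m \<ge> 1" "finite Q" "Q \<subseteq> Pow V"
    and small: "real (card Q) * real m * exp (- chernoff_rate \<delta> * real k / real m) < 1"
  shows "\<exists>c \<in> V \<rightarrow>\<^sub>E {..<m}. \<forall>S\<in>Q.
           colour_capped_card m k ((1 + \<delta>) * real k / real m) c S = capped_card k S"
proof (rule ccontr)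
  assume none: "\<not> ?thesis"
  let ?C = "V \<rightarrow>\<^sub>E {..<m}" and ?b = "(1 + \<delta>) * real k / real m"
  let ?D = "\<lambda>S. {c \<in> ?C. colour_capped_card m k ?b c S \<noteq> capped_card k S}"
  have finC: "finite ?C" using assms(1) by (intro finite_PiE) auto
  have "?C \<subseteq> (\<Union>S\<in>Q. ?D S)" using none by auto
  then have "card ?C \<le> card (\<Union>S\<in>Q. ?D S)"
    using finC assms(4) by (intro card_mono) auto
  also have "\<dots> \<le> (\<Sum>S\<in>Q. card (?D S))" using assms(4) by (rule card_UN_le)
  finally have "real (card ?C) \<le> (\<Sum>S\<in>Q. real (card (?D S)))"
    by (simp only: of_nat_sum[symmetric] of_nat_le_iff)
  also have "\<dots> \<le> (\<Sum>S\<in>Q. real m * (real m ^ card V * exp (- chernoff_rate \<delta> * real k / real m)))"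
    using assms by (intro sum_mono card_distinguishing_colourings) auto
  also have "\<dots> = real m ^ card V * (real (card Q) * real m * exp (- chernoff_rate \<delta> * real k / real m))"
    by (simp add: mult_ac)
  also have "\<dots> < real m ^ card V * 1"
    using assms(3) by (intro mult_strict_left_mono[OF small]) simp
  finally show False using assms(1) by (simp add: card_PiE)
qed

section \<open>Query algorithms\<close>

text \<open>\<open>Q\<close> collects the queries along this one run. Equal answers lead to the same
  continuations, hence to the same later queries, and the coin tosses are those of the run. Repeated
  queries are the reason for \<open>\<le>\<close> in \<open>card Q \<le> q\<close>.\<close>

lemma run_result_depends_on_queries:
  assumes "run_result orc a q A"
  shows "\<exists>Q. finite Q \<and> card Q \<le> q \<and>
           (\<forall>orc'. (\<forall>(i, S)\<in>Q. orc' i S = orc i S) \<longrightarrow> run_result orc' a q A)"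
  using assms
proof induction
  case (1 A)
  show ?case by (rule exI[of _ "{}"]) (auto intro: run_result.intros)
next
  case (2 k i S q A)
  then obtain Q where Q: "finite Q" "card Q \<le> q"
    "\<And>orc'. \<forall>(i, S)\<in>Q. orc' i S = orc i S \<Longrightarrow> run_result orc' (k (orc i S)) q A"
    by blast
  show ?case
  proof (intro exI[of _ "insert (i, S) Q"] conjI allI impI)
    show "card (insert (i, S) Q) \<le> Suc q"
      using Q(1,2) by (simp add: card_insert_if)
  next
    fix orc' assume agree: "\<forall>(i, S)\<in>insert (i, S) Q. orc' i S = orc i S"
    then have "run_result orc' (k (orc' i S)) q A" using Q(3)[of orc'] by simp
    then show "run_result orc' (Query i S k) (Suc q) A" by (rule run_result.intros)
  qed (use Q in simp)
next
  case (3 k b q A)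
  then obtain Q where Q: "finite Q" "card Q \<le> q"
    "\<And>orc'. \<forall>(i, S)\<in>Q. orc' i S = orc i S \<Longrightarrow> run_result orc' (k b) q A"
    by blast
  show ?case
    by (intro exI[of _ Q] conjI Q(1,2) allI impI, rule run_result.intros(3)[where b = b], rule Q(3))
qed

section \<open>Loads of partitions and the lower bound on a fixed ground set\<close>

lemma ordered_partition_large_block:
  assumes "A \<in> ordered_partitions V m" "finite V" "m * (k - 1) < card V"
  shows "\<exists>i<m. A ! i \<subseteq> V \<and> k \<le> card (A ! i)"
proof (rule ccontr)
  assume none: "\<not> ?thesis"
  have V: "(\<Union>i<m. A ! i) = V" using assms(1) by (simp add: ordered_partitions_def)
  have "card V \<le> (\<Sum>i<m. card (A ! i))"
    using card_UN_le[of "{..<m}" "\<lambda>i. A ! i"] V by simp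
  also have "\<dots> \<le> (\<Sum>i<m. k - 1)"
  proof (rule sum_mono)
    fix i assume i: "i \<in> {..<m}"
    then have "A ! i \<subseteq> V" using V by blast
    then show "card (A ! i) \<le> k - 1" using none i by fastforce
  qed
  finally show False using assms(3) by simp
qed

text \<open>The colour classes are themselves a partition, and on each class only its own colour
  contributes.\<close>

lemma slb_opt_colour_capped_card:
  assumes "finite V" "m \<ge> 1" "\<beta> \<ge> 0" "c \<in> V \<rightarrow>\<^sub>E {..<m}"
  shows "slb_opt V m (\<lambda>_. colour_capped_card m k \<beta> c) \<le> \<beta>"
proof -
  let ?f = "\<lambda>_::nat. colour_capped_card m k \<beta> c"
  let ?P = "map (\<lambda>i. {v \<in> V. c v = i}) [0..<m]"
  have P: "?P \<in> ordered_partitions V m"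
    using assms(4) by (auto simp: ordered_partitions_def disjoint_family_on_def)
  have "colour_capped_card m k \<beta> c {v \<in> V. c v = i} \<le> \<beta>" if "i < m" for i
  proof -
    have "(\<Sum>j<m. min \<beta> (real (card {v \<in> {v \<in> V. c v = i}. c v = j})))
        = (\<Sum>j<m. if j = i then min \<beta> (real (card {v \<in> V. c v = i})) else 0)"
      using assms(3) by (intro sum.cong) (auto simp: min_def cong: conj_cong)
    also have "\<dots> = min \<beta> (real (card {v \<in> V. c v = i}))" using that by simp
    finally show ?thesis unfolding colour_capped_card_def by linarith
  qed
  then have "max_load m ?f ?P \<le> \<beta>"
    using assms(2) unfolding max_load_def by (subst Max_le_iff) (auto simp: lessThan_empty_iff)
  moreover have "slb_opt V m ?f \<le> max_load m ?f ?P"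
    unfolding slb_opt_def using P finite_ordered_partitions[OF assms(1)] by (intro Min_le) auto
  ultimately show ?thesis by linarith
qed

text \<open>Serves the case \<open>\<epsilon> > 1\<close>, where the factor
  \<open>(1 - \<epsilon>) * m\<close> is negative and an upper bound on the optimum says
  nothing.\<close>

lemma slb_opt_nonneg:
  assumes "finite V" "m \<ge> 1" "f \<in> slb_instances V m"
  shows "slb_opt V m f \<ge> 0"
proof -
  have "max_load m f A \<ge> 0" if A: "A \<in> ordered_partitions V m" for A
  proof -
    have "A ! 0 \<subseteq> V" using A assms(2) by (force simp: ordered_partitions_def)
    then have "f 0 {} \<le> f 0 (A ! 0)"
      using assms by (auto simp: slb_instances_def dest: mono_onD)
    then have "0 \<le> f 0 (A ! 0)"
      using assms by (auto simp: slb_instances_def normalized_def)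
    also have "\<dots> \<le> max_load m f A"
      unfolding max_load_def using assms(2) by (intro Max_ge) auto
    finally show ?thesis .
  qed
  then show ?thesis
    unfolding slb_opt_def
    using finite_ordered_partitions[OF assms(1)] ordered_partitions_nonempty[OF assms(2)]
    by (subst Min_ge_iff) auto
qed

text \<open>The argument for one ground set. In \<open>small\<close>, the term
  \<open>B + real m\<close> bounds the number of sets on which the colouring must stay invisible:
  the queried sets and the output blocks.\<close>

lemma query_lower_bound:
  fixes a :: "'v query_alg"
  assumes "finite V" "m \<ge> 1" "\<epsilon> > 0" "k \<ge> 1" "m * (k - 1) < card V"
    and queries: "\<And>f q A. f \<in> homogeneous_slb_instances V m \<Longrightarrow>
           run_result (value_oracle V m f) a q A \<Longrightarrow> real q \<le> B"
    and small: "(B + real m) * real m * exp (- chernoff_rate \<epsilon> * real k / real m) < 1"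
  shows "\<not> approximates_slb_on (homogeneous_slb_instances V m) V m ((1 - \<epsilon>) * real m) a"
proof
  assume approx: "approximates_slb_on (homogeneous_slb_instances V m) V m ((1 - \<epsilon>) * real m) a"
  let ?b = "(1 + \<epsilon>) * real k / real m"
  have b: "?b \<ge> 0" using assms by simp
  let ?f = "\<lambda>_::nat. capped_card k :: 'v set \<Rightarrow> real"
  have f: "?f \<in> homogeneous_slb_instances V m" by (rule capped_card_instance[OF assms(1)])
  \<comment> \<open>A single run suffices, since the guarantees on output and query count hold for
    every outcome of the coin tosses.\<close>
  obtain q A where run: "run_result (value_oracle V m ?f) a q A"
    using run_result_exists by blast
  have A: "A \<in> ordered_partitions V m" and q: "real q \<le> B"
    using approx f run queries unfolding approximates_slb_on_def by blast+
  obtain Q where Q: "finite Q" "card Q \<le> q"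
    "\<And>orc'. \<forall>(i, S)\<in>Q. orc' i S = value_oracle V m ?f i S \<Longrightarrow> run_result orc' a q A"
    using run_result_depends_on_queries[OF run] by blast
  define R where "R = (snd ` Q \<union> (\<lambda>i. A ! i) ` {..<m}) \<inter> Pow V"
  have "card R \<le> card (snd ` Q \<union> (\<lambda>i. A ! i) ` {..<m})"
    unfolding R_def using Q(1) by (intro card_mono) auto
  also have "\<dots> \<le> card (snd ` Q) + card ((\<lambda>i. A ! i) ` {..<m})" by (rule card_Un_le)
  also have "\<dots> \<le> q + m"
    using card_image_le[OF Q(1), of snd] Q(2) card_image_le[of "{..<m}" "\<lambda>i. A ! i"]
    by (simp add: add_mono)
  finally have "real (card R) \<le> B + real m" using q by linarith
  then have "real (card R) * real m * exp (- chernoff_rate \<epsilon> * real k / real m)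
      \<le> (B + real m) * real m * exp (- chernoff_rate \<epsilon> * real k / real m)"
    by (intro mult_right_mono) auto
  also note small
  finally have "\<exists>c \<in> V \<rightarrow>\<^sub>E {..<m}. \<forall>S\<in>R. colour_capped_card m k ?b c S = capped_card k S"
    using Q(1) assms(1-3)
    by (intro exists_indistinguishable_colouring) (auto simp: R_def)
  then obtain c where c: "c \<in> V \<rightarrow>\<^sub>E {..<m}"
    and eq: "\<And>S. S \<in> R \<Longrightarrow> colour_capped_card m k ?b c S = capped_card k S"
    by blast
  let ?g = "\<lambda>_::nat. colour_capped_card m k ?b c"
  have g: "?g \<in> homogeneous_slb_instances V m"
    using assms(1) b by (rule colour_capped_card_instance)
  have "\<forall>(i, S)\<in>Q. value_oracle V m ?g i S = value_oracle V m ?f i S"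
    using eq by (force simp: value_oracle_def R_def)
  then have load: "max_load m ?g A \<le> (1 - \<epsilon>) * real m * slb_opt V m ?g"
    using approx g Q(3) unfolding approximates_slb_on_def by blast
  obtain i where i: "i < m" "A ! i \<subseteq> V" "k \<le> card (A ! i)"
    using ordered_partition_large_block[OF A assms(1,5)] by blast
  \<comment> \<open>The large block has value \<open>k\<close> under the reference instance, and it
    lies in \<open>R\<close>.\<close>
  have "real k = colour_capped_card m k ?b c (A ! i)"
    using i by (subst eq) (auto simp: R_def capped_card_def)
  also have "\<dots> \<le> max_load m ?g A"
    unfolding max_load_def using i by (intro Max_ge) auto
  also note load
  also have "(1 - \<epsilon>) * real m * slb_opt V m ?g < real k"
  proof (cases "\<epsilon> \<le> 1")
    case True
    have "(1 - \<epsilon>) * real m * slb_opt V m ?g \<le> (1 - \<epsilon>) * real m * ?b"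
      using True slb_opt_colour_capped_card[OF assms(1,2) b c]
      by (intro mult_left_mono) auto
    \<comment> \<open>The slack \<open>1 + \<epsilon>\<close> in the cap loses to the factor
      \<open>1 - \<epsilon>\<close>.\<close>
    also have "\<dots> = (1 - \<epsilon> * \<epsilon>) * real k"
      using assms(2) by (simp add: field_simps)
    also have "\<dots> < 1 * real k"
      using assms(3,4) by (intro mult_strict_right_mono) auto
    finally show ?thesis by simp
  next
    case False
    have "slb_opt V m ?g \<ge> 0"
      using g by (intro slb_opt_nonneg[OF assms(1,2)]) (simp add: homogeneous_slb_instances_def)
    then have "(1 - \<epsilon>) * real m * slb_opt V m ?g \<le> 0"
      using False by (intro mult_nonpos_nonneg) auto
    then show ?thesis using assms(4) by linarith
  qed
  finally show False by simp
qed

section \<open>Asymptotics\<close>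

lemma poly_eventually_le_power:
  fixes p :: "real poly"
  shows "\<exists>d. \<forall>\<^sub>F x in at_top. poly p x \<le> x ^ d"
proof (induction p)
  case 0
  show ?case
    by (rule exI[of _ 0]) simp
next
  case (pCons a p)
  then obtain d where d: "\<forall>\<^sub>F x in at_top. poly p x \<le> x ^ d" by blast
  \<comment> \<open>One extra power comes from multiplying \<open>p\<close> by \<open>x\<close>, the
    other absorbs the factor 2 from adding \<open>a\<close>.\<close>
  have "\<forall>\<^sub>F x in at_top. poly (pCons a p) x \<le> x ^ (d + 2)"
    using d eventually_ge_at_top[of 2] eventually_ge_at_top[of "\<bar>a\<bar>"]
  proof eventually_elim
    case (elim x)
    have "x * 1 \<le> x * x ^ d" using elim by (intro mult_left_mono) auto
    then have "a \<le> x * x ^ d" using elim by linarith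
    moreover have "x * poly p x \<le> x * x ^ d" using elim by (intro mult_left_mono) auto
    moreover have "2 * (x * x ^ d) \<le> x * (x * x ^ d)" using elim by (intro mult_right_mono) auto
    ultimately show ?case by simp
  qed
  then show ?case by blast
qed

text \<open>The growth condition makes \<open>n / m\<^sup>2\<close> exceed every constant multiple
  of \<open>ln n\<close> eventually. So the exponential is at most \<open>1 / n ^ (d + 3)\<close>,
  against a prefactor of at most \<open>2 * n ^ (d + 2)\<close>.\<close>

lemma polynomial_times_exp_small:
  fixes m :: "nat \<Rightarrow> nat" and p :: "real poly"
  assumes "r > 0" "\<And>n. m n \<ge> 1"
    and m: "(\<lambda>n. real (m n)) \<in> o(\<lambda>n. sqrt (real n / ln (real n)))"
  shows "\<forall>\<^sub>F n in sequentially.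
    (poly p (real n) + real (m n)) * real (m n) * exp (- r * real n / (real (m n))\<^sup>2) < 1"
proof -
  obtain d where d: "\<forall>\<^sub>F x in at_top. poly p x \<le> x ^ d"
    using poly_eventually_le_power by blast
  have pn: "\<forall>\<^sub>F n in sequentially. poly p (real n) \<le> real n ^ d"
    using eventually_compose_filterlim[OF d filterlim_real_sequentially] .
  \<comment> \<open>The root yields \<open>e\<^sup>2 * (d + 3) \<le> r\<close>, which gives the
    exponent \<open>d + 3\<close>; the cap 1 yields \<open>m \<le> n\<close>.\<close>
  define e where "e = min 1 (sqrt (r / real (d + 3)))"
  have e: "e > 0" "e \<le> 1" using assms(1) by (auto simp: e_def)
  have "e\<^sup>2 \<le> (sqrt (r / real (d + 3)))\<^sup>2"
    using e by (intro power_mono) (auto simp: e_def)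
  then have e2: "e\<^sup>2 * real (d + 3) \<le> r"
    using assms(1) by (simp add: field_simps)
  \<comment> \<open>From \<open>n \<ge> 3\<close> follow \<open>ln n \<ge> 1\<close>, by
    \<open>exp 1 \<le> 3\<close>, and \<open>2 / n < 1\<close> at the end.\<close>
  show ?thesis
    using pn landau_o.smallD[OF m e(1)] eventually_ge_at_top[of 3]
  proof eventually_elim
    case (elim n)
    let ?n = "real n" and ?m = "real (m n)"
    have n3: "?n \<ge> 3" using elim by simp
    have m1: "?m \<ge> 1" using assms(2)[of n] by simp
    have "exp 1 \<le> ?n" using n3 exp_le by linarith
    then have ln1: "ln ?n \<ge> 1" using n3 by (subst ln_ge_iff) auto
    have "?m \<le> e * sqrt (?n / ln ?n)" using elim(2) ln1 by simp
    then have "?m\<^sup>2 \<le> (e * sqrt (?n / ln ?n))\<^sup>2" by (intro power_mono) auto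
    also have "\<dots> = e\<^sup>2 * ?n / ln ?n" using ln1 by (simp add: power_mult_distrib)
    finally have "?m\<^sup>2 \<le> e\<^sup>2 * ?n / ln ?n" .
    then have m2: "?m\<^sup>2 * ln ?n \<le> e\<^sup>2 * ?n" using ln1 by (simp add: field_simps)
    have "?m \<le> ?m\<^sup>2 * ln ?n"
    proof -
      have "?m * 1 \<le> ?m * (?m * ln ?n)"
        using m1 ln1 mult_mono[of 1 ?m 1 "ln ?n"] by (intro mult_left_mono) auto
      then show ?thesis by (simp add: power2_eq_square mult_ac)
    qed
    also note m2
    also have "e\<^sup>2 * ?n \<le> 1 * ?n" using e by (intro mult_right_mono) (auto simp: power_le_one)
    finally have mn: "?m \<le> ?n" by simp
    have "real (d + 3) * ln ?n * ?m\<^sup>2 \<le> real (d + 3) * (e\<^sup>2 * ?n)"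
      using mult_left_mono[OF m2, of "real (d + 3)"] by (simp add: mult_ac)
    also have "\<dots> \<le> r * ?n" using mult_right_mono[OF e2, of ?n] by (simp add: mult_ac)
    finally have "real (d + 3) * ln ?n \<le> r * ?n / ?m\<^sup>2" using m1 by (simp add: field_simps)
    then have "exp (- r * ?n / ?m\<^sup>2) \<le> exp (- (real (d + 3) * ln ?n))" by simp
    also have "\<dots> = 1 / ?n ^ (d + 3)"
      using n3 by (simp only: exp_minus exp_of_nat_mult) (simp add: inverse_eq_divide)
    finally have ex: "exp (- r * ?n / ?m\<^sup>2) \<le> 1 / ?n ^ (d + 3)" .
    have pw: "?n ^ d \<le> ?n ^ (d + 1)" "?n \<le> ?n ^ (d + 1)"
      using n3 by (auto intro: power_increasing self_le_power)
    have "poly p ?n + ?m \<le> 2 * ?n ^ (d + 1)" using elim(1) mn pw by linarith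
    then have "(poly p ?n + ?m) * ?m \<le> (2 * ?n ^ (d + 1)) * ?n"
      using mn m1 n3 by (intro mult_mono) auto
    then have "(poly p ?n + ?m) * ?m * exp (- r * ?n / ?m\<^sup>2)
        \<le> ((2 * ?n ^ (d + 1)) * ?n) * (1 / ?n ^ (d + 3))"
      by (rule mult_mono[OF _ ex]) (use n3 in auto)
    also have "\<dots> = 2 / ?n" using n3 by (simp add: power_add field_simps power3_eq_cube)
    also have "\<dots> < 1" using n3 by simp
    finally show ?case .
  qed
qed

theorem theorem6:
  fixes \<epsilon> :: real
    and m :: "nat \<Rightarrow> nat"
    and V :: "nat \<Rightarrow> 'v set"
    and alg :: "nat \<Rightarrow> 'v query_alg"
  assumes "\<epsilon> > 0"
    and "\<And>n. finite (V n)" and "\<And>n. card (V n) = n"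
    and "\<And>n. m n \<ge> 1"
    and "(\<lambda>n. real (m n)) \<in> o(\<lambda>n. sqrt (real n / ln (real n)))"
    and "polynomially_many_queries_on (\<lambda>n. homogeneous_slb_instances (V n) (m n)) V m alg"
  shows "\<forall>\<^sub>F n in sequentially.
           \<not> approximates_slb_on (homogeneous_slb_instances (V n) (m n)) (V n) (m n)
               ((1 - \<epsilon>) * real (m n)) (alg n)"
proof -
  obtain p :: "real poly" where p: "\<And>n f q A. f \<in> homogeneous_slb_instances (V n) (m n) \<Longrightarrow>
      run_result (value_oracle (V n) (m n) f) (alg n) q A \<Longrightarrow> real q \<le> poly p (real n)"
    using assms(6) unfolding polynomially_many_queries_on_def by blast
  note r = chernoff_rate_pos[OF assms(1)]
  show ?thesis
    using polynomial_times_exp_small[OF r assms(4,5), of p] eventually_ge_at_top[of 1]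
  proof eventually_elim
    case (elim n)
    \<comment> \<open>This is the ceiling of \<open>n / m\<close>, written so that division with
      remainder gives \<open>m * (k - 1) \<le> n - 1 < m * k\<close>.\<close>
    define k where "k = Suc ((n - 1) div m n)"
    have m1: "m n \<ge> 1" by (rule assms(4))
    have k_upper: "m n * (k - 1) < card (V n)"
    proof -
      have "m n * ((n - 1) div m n) \<le> n - 1" by simp
      then have "m n * ((n - 1) div m n) < n" using elim(2) by linarith
      then show ?thesis by (simp add: k_def assms(3))
    qed
    have "n - 1 < m n * k"
      using m1 dividend_less_times_div[of "m n" "n - 1"] by (simp add: k_def)
    then have "real n \<le> real (m n) * real k"
      using elim(2) by (metis Suc_leI Suc_pred' less_eq_Suc_le of_nat_le_iff of_nat_mult One_nat_def)
    \<comment> \<open>The mean size \<open>k / m\<close> of a colour class within \<open>k\<close>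
      elements is at least \<open>n / m\<^sup>2\<close>, which brings in the asymptotic
      estimate.\<close>
    then have "real n / (real (m n))\<^sup>2 \<le> real k / real (m n)"
      using m1 by (simp add: field_simps power2_eq_square)
    then have exp_le: "exp (- chernoff_rate \<epsilon> * real k / real (m n))
        \<le> exp (- chernoff_rate \<epsilon> * real n / (real (m n))\<^sup>2)"
      using mult_left_mono[of _ _ "chernoff_rate \<epsilon>"] r by fastforce
    \<comment> \<open>Some run exists, and its query count is a natural number below the
      bound.\<close>
    have "0 \<le> poly p (real n)"
    proof -
      obtain q A where "run_result (value_oracle (V n) (m n) (\<lambda>_. capped_card k)) (alg n) q A"
        using run_result_exists by blast
      from p[OF capped_card_instance[OF assms(2)] this] show ?thesis by linarith
    qed
    then have "(poly p (real n) + real (m n)) * real (m n) * exp (- chernoff_rate \<epsilon> * real k / real (m n))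
        \<le> (poly p (real n) + real (m n)) * real (m n) * exp (- chernoff_rate \<epsilon> * real n / (real (m n))\<^sup>2)"
      by (intro mult_left_mono exp_le) auto
    then have small: "(poly p (real n) + real (m n)) * real (m n)
        * exp (- chernoff_rate \<epsilon> * real k / real (m n)) < 1"
      using elim(1) by linarith
    show ?case
      using query_lower_bound[OF assms(2) m1 assms(1) _ k_upper p small] by (simp add: k_def)
  qed
qed

end
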